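(* Let $p:\mathbb E\to\mathbb B$ be a posetal fibration with fibred small limits and $\mathcal T$ a monad on $\mathbb B$. For any lifting $\dot{\mathcal T}$ of $\mathcal T$ along $p$, $\dot T=\bigwedge_{X\in\mathbb E}[q_X(\dot T)]^{pX}$.
   Context: $p$ posetal: fibres are posets; $p$ faithful and $\mathbb E(X,Y)\subseteq\mathbb B(pX,pY)$. Fibres have arbitrary meets. $\mathcal T=(T,\eta,\mu)$, $f^\#=\mu\circ Tf$. $\mathbf{Lift}(\mathcal T)$ is the class of liftings of $\mathcal T$ along $p$ (monads on $\mathbb E$ with $p\dot T=Tp$, $p\dot\eta=\eta p$, $p\dot\mu=\mu p$), ordered by $\dot T\preceq\dot T'$ iff $\dot TY\le\dot T'Y$ for all $Y$; it has arbitrary (class-size) meets computed pointwise: $(\bigwedge_i\dot T_i)Y=\bigwedge_i\dot T_iY$. For $R\in\mathbb B$, $S\in\mathbb E_{TR}$, $[S]^R$ is the (pointwise) codensity lifting with single parameter $(R,S)$, a lifting with $[S]^RY=\bigwedge_{f\in\mathbb E(Y,S)}(f^\#)^{-1}(S)$. $q_X(\dot T)=\dot TX$. *)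

theory Defs
  imports "HOL-Algebra.Lattice" "HOL-Library.FuncSet"
begin

section \<open>Categories, functors and monads\<close>

record ('o, 'a) cat =
  Obj :: "'o set"
  Arr :: "'a set"
  Dom :: "'a \<Rightarrow> 'o"
  Cod :: "'a \<Rightarrow> 'o"
  Idn :: "'o \<Rightarrow> 'a"
  Cmp :: "'a \<Rightarrow> 'a \<Rightarrow> 'a"  (infixl \<open>\<cdot>\<index>\<close> 70)

definition Hom :: "('o, 'a) cat \<Rightarrow> 'o \<Rightarrow> 'o \<Rightarrow> 'a set" where
  "Hom C X Y = {f \<in> Arr C. Dom C f = X \<and> Cod C f = Y}"

locale category =
  fixes C :: "('o, 'a) cat" (structure)
  assumes Dom_closed: "f \<in> Arr C \<Longrightarrow> Dom C f \<in> Obj C"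
    and Cod_closed: "f \<in> Arr C \<Longrightarrow> Cod C f \<in> Obj C"
    and Idn_closed: "X \<in> Obj C \<Longrightarrow> Idn C X \<in> Hom C X X"
    and Cmp_closed: "\<lbrakk>f \<in> Hom C X Y; g \<in> Hom C Y Z\<rbrakk> \<Longrightarrow> g \<cdot> f \<in> Hom C X Z"
    and Idn_right: "f \<in> Hom C X Y \<Longrightarrow> f \<cdot> Idn C X = f"
    and Idn_left: "f \<in> Hom C X Y \<Longrightarrow> Idn C Y \<cdot> f = f"
    and Cmp_assoc: "\<lbrakk>f \<in> Hom C W X; g \<in> Hom C X Y; h \<in> Hom C Y Z\<rbrakk> \<Longrightarrow> (h \<cdot> g) \<cdot> f = h \<cdot> (g \<cdot> f)"

record ('o, 'a, 'x, 'b) cfunctor =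
  fobj :: "'o \<Rightarrow> 'x"
  farr :: "'a \<Rightarrow> 'b"

text \<open>
  The components of functors and monads are \<^const>\<open>extensional\<close>, that is \<^const>\<open>undefined\<close>
  off the objects (arrows) of their source category.  With this convention equality of records
  is equality of functors and of monads.
\<close>

locale cat_functor = C: category C + D: category D
  for C :: "('o, 'a) cat" and D :: "('x, 'b) cat" +
  fixes F :: "('o, 'a, 'x, 'b, 'z) cfunctor_scheme"
  assumes fobj_closed: "fobj F \<in> Obj C \<rightarrow>\<^sub>E Obj D"
    and farr_ext: "farr F \<in> extensional (Arr C)"
    and farr_closed: "f \<in> Hom C X Y \<Longrightarrow> farr F f \<in> Hom D (fobj F X) (fobj F Y)"
    and farr_Idn: "X \<in> Obj C \<Longrightarrow> farr F (Idn C X) = Idn D (fobj F X)"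
    and farr_Cmp: "\<lbrakk>f \<in> Hom C X Y; g \<in> Hom C Y Z\<rbrakk> \<Longrightarrow>
      farr F (g \<cdot>\<^bsub>C\<^esub> f) = farr F g \<cdot>\<^bsub>D\<^esub> farr F f"

record ('o, 'a) cmonad = "('o, 'a, 'o, 'a) cfunctor" +
  munit :: "'o \<Rightarrow> 'a"
  mmult :: "'o \<Rightarrow> 'a"

locale cat_monad = cat_functor C C T
  for C :: "('o, 'a) cat" (structure) and T :: "('o, 'a) cmonad" +
  assumes munit_ext: "munit T \<in> extensional (Obj C)"
    and mmult_ext: "mmult T \<in> extensional (Obj C)"
    and munit_closed: "X \<in> Obj C \<Longrightarrow> munit T X \<in> Hom C X (fobj T X)"
    and mmult_closed: "X \<in> Obj C \<Longrightarrow> mmult T X \<in> Hom C (fobj T (fobj T X)) (fobj T X)"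
    and munit_natural: "f \<in> Hom C X Y \<Longrightarrow> farr T f \<cdot> munit T X = munit T Y \<cdot> f"
    and mmult_natural: "f \<in> Hom C X Y \<Longrightarrow>
      farr T f \<cdot> mmult T X = mmult T Y \<cdot> farr T (farr T f)"
    and mmult_munit: "X \<in> Obj C \<Longrightarrow> mmult T X \<cdot> munit T (fobj T X) = Idn C (fobj T X)"
    and mmult_farr_munit: "X \<in> Obj C \<Longrightarrow> mmult T X \<cdot> farr T (munit T X) = Idn C (fobj T X)"
    and mmult_assoc: "X \<in> Obj C \<Longrightarrow>
      mmult T X \<cdot> mmult T (fobj T X) = mmult T X \<cdot> farr T (mmult T X)"

text \<open>The Kleisli extension \<open>u\<^sup>#\<close> of \<open>u : I \<rightarrow> T R\<close>.\<close>

definition kleisli_ext :: "('o, 'a) cat \<Rightarrow> ('o, 'a) cmonad \<Rightarrow> 'o \<Rightarrow> 'a \<Rightarrow> 'a" where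
  "kleisli_ext C T R u = mmult T R \<cdot>\<^bsub>C\<^esub> farr T u"


section \<open>Posetal fibrations\<close>

definition cartesian ::
  "('eo, 'ea) cat \<Rightarrow> ('bo, 'ba) cat \<Rightarrow> ('eo, 'ea, 'bo, 'ba) cfunctor \<Rightarrow> 'ea \<Rightarrow> bool" where
  "cartesian E B p c \<longleftrightarrow> c \<in> Arr E \<and>
    (\<forall>Z\<in>Obj E. \<forall>g\<in>Hom E Z (Cod E c). \<forall>w\<in>Hom B (fobj p Z) (fobj p (Dom E c)).
      farr p g = farr p c \<cdot>\<^bsub>B\<^esub> w \<longrightarrow>
      (\<exists>!h. h \<in> Hom E Z (Dom E c) \<and> farr p h = w \<and> c \<cdot>\<^bsub>E\<^esub> h = g))"

locale fibration = p: cat_functor E B p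
  for E :: "('eo, 'ea) cat" and B :: "('bo, 'ba) cat" and p :: "('eo, 'ea, 'bo, 'ba) cfunctor" +
  assumes cartesian_lift: "\<lbrakk>Y \<in> Obj E; u \<in> Hom B I (fobj p Y)\<rbrakk> \<Longrightarrow>
    \<exists>c. cartesian E B p c \<and> Cod E c = Y \<and> farr p c = u"

text \<open>The fibre over \<open>I\<close>, with \<open>X \<le> Y\<close> iff there is a vertical arrow \<open>X \<rightarrow> Y\<close>.\<close>

definition fibre ::
  "('eo, 'ea) cat \<Rightarrow> ('bo, 'ba) cat \<Rightarrow> ('eo, 'ea, 'bo, 'ba) cfunctor \<Rightarrow> 'bo \<Rightarrow> 'eo gorder" where
  "fibre E B p I =
    \<lparr>carrier = {X \<in> Obj E. fobj p X = I},
     eq = (=),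
     le = (\<lambda>X Y. \<exists>f\<in>Hom E X Y. farr p f = Idn B I)\<rparr>"

text \<open>The fibre categories are posets: thin, with antisymmetric order.\<close>

locale posetal_fibration = fibration E B p
  for E :: "('eo, 'ea) cat" and B :: "('bo, 'ba) cat" and p :: "('eo, 'ea, 'bo, 'ba) cfunctor" +
  assumes fibre_thin: "\<lbrakk>I \<in> Obj B; f \<in> Hom E X Y; g \<in> Hom E X Y;
      farr p f = Idn B I; farr p g = Idn B I\<rbrakk> \<Longrightarrow> f = g"
    and fibre_order: "I \<in> Obj B \<Longrightarrow> partial_order (fibre E B p I)"

text \<open>
  The object \<open>u\<^sup>-\<^sup>1 Y\<close>.  In a posetal fibration the domain of a cartesian arrow over \<open>u\<close>
  with codomain \<open>Y\<close> is unique.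
\<close>

definition reindex :: "('eo, 'ea) cat \<Rightarrow> ('bo, 'ba) cat \<Rightarrow> ('eo, 'ea, 'bo, 'ba) cfunctor \<Rightarrow>
    'ba \<Rightarrow> 'eo \<Rightarrow> 'eo" where
  "reindex E B p u Y =
    (THE X. \<exists>c. cartesian E B p c \<and> Dom E c = X \<and> Cod E c = Y \<and> farr p c = u)"

text \<open>
  A limit in a poset is the meet of the objects of the diagram, so fibred small limits are meets of
  arbitrary subsets of the fibres, preserved by reindexing.
\<close>

locale posetal_fibration_limits = posetal_fibration E B p
  for E :: "('eo, 'ea) cat" and B :: "('bo, 'ba) cat" and p :: "('eo, 'ea, 'bo, 'ba) cfunctor" +
  assumes fibre_meets: "\<lbrakk>I \<in> Obj B; A \<subseteq> carrier (fibre E B p I)\<rbrakk> \<Longrightarrow>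
      \<exists>M. is_glb (fibre E B p I) M A"
    and reindex_meets: "\<lbrakk>u \<in> Hom B I J; A \<subseteq> carrier (fibre E B p J); is_glb (fibre E B p J) M A\<rbrakk> \<Longrightarrow>
      is_glb (fibre E B p I) (reindex E B p u M) (reindex E B p u ` A)"


section \<open>Liftings\<close>

definition Lift :: "('eo, 'ea) cat \<Rightarrow> ('bo, 'ba) cat \<Rightarrow> ('eo, 'ea, 'bo, 'ba) cfunctor \<Rightarrow>
    ('bo, 'ba) cmonad \<Rightarrow> ('eo, 'ea) cmonad set" where
  "Lift E B p T = {T'. cat_monad E T' \<and>
    (\<forall>X\<in>Obj E. fobj p (fobj T' X) = fobj T (fobj p X)) \<and>
    (\<forall>f\<in>Arr E. farr p (farr T' f) = farr T (farr p f)) \<and>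
    (\<forall>X\<in>Obj E. farr p (munit T' X) = munit T (fobj p X)) \<and>
    (\<forall>X\<in>Obj E. farr p (mmult T' X) = mmult T (fobj p X))}"

definition lift_order :: "('eo, 'ea) cat \<Rightarrow> ('bo, 'ba) cat \<Rightarrow> ('eo, 'ea, 'bo, 'ba) cfunctor \<Rightarrow>
    ('bo, 'ba) cmonad \<Rightarrow> ('eo, 'ea) cmonad gorder" where
  "lift_order E B p T =
    \<lparr>carrier = Lift E B p T,
     eq = (=),
     le = (\<lambda>T' T''. \<forall>Y\<in>Obj E. fobj T' Y \<sqsubseteq>\<^bsub>fibre E B p (fobj T (fobj p Y))\<^esub> fobj T'' Y)\<rparr>"

definition q :: "'eo \<Rightarrow> ('eo, 'ea) cmonad \<Rightarrow> 'eo" where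
  "q X T' = fobj T' X"

text \<open>
  As \<open>p\<close> is faithful, there is at most one arrow \<open>X \<rightarrow> Y\<close> over a given \<open>u\<close>, and a lifting is
  determined by its action \<open>G\<close> on objects.
\<close>

definition arrow_over :: "('eo, 'ea) cat \<Rightarrow> ('eo, 'ea, 'bo, 'ba) cfunctor \<Rightarrow>
    'eo \<Rightarrow> 'eo \<Rightarrow> 'ba \<Rightarrow> 'ea" where
  "arrow_over E p X Y u = (THE f. f \<in> Hom E X Y \<and> farr p f = u)"

definition lifting_of :: "('eo, 'ea) cat \<Rightarrow> ('eo, 'ea, 'bo, 'ba) cfunctor \<Rightarrow>
    ('bo, 'ba) cmonad \<Rightarrow> ('eo \<Rightarrow> 'eo) \<Rightarrow> ('eo, 'ea) cmonad" where
  "lifting_of E p T G =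
    \<lparr>fobj = (\<lambda>Y\<in>Obj E. G Y),
     farr = (\<lambda>f\<in>Arr E. arrow_over E p (G (Dom E f)) (G (Cod E f)) (farr T (farr p f))),
     munit = (\<lambda>Y\<in>Obj E. arrow_over E p Y (G Y) (munit T (fobj p Y))),
     mmult = (\<lambda>Y\<in>Obj E. arrow_over E p (G (G Y)) (G Y) (mmult T (fobj p Y)))\<rparr>"

text \<open>The codensity lifting \<open>[S]\<^sup>R\<close>, for \<open>S\<close> in the fibre over \<open>T R\<close>.\<close>

definition codensity_lifting :: "('eo, 'ea) cat \<Rightarrow> ('bo, 'ba) cat \<Rightarrow>
    ('eo, 'ea, 'bo, 'ba) cfunctor \<Rightarrow> ('bo, 'ba) cmonad \<Rightarrow> 'bo \<Rightarrow> 'eo \<Rightarrow> ('eo, 'ea) cmonad" where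
  "codensity_lifting E B p T R S = lifting_of E p T
    (\<lambda>Y. IINF\<^bsub>fibre E B p (fobj T (fobj p Y))\<^esub> f:Hom E Y S.
      reindex E B p (kleisli_ext B T R (farr p f)) S)"


section \<open>Liftings form a partial order with pointwise meets, and codensity liftings are liftings\<close>

lemma HomD:
  "f \<in> Hom C X Y \<Longrightarrow> f \<in> Arr C"
  "f \<in> Hom C X Y \<Longrightarrow> Dom C f = X"
  "f \<in> Hom C X Y \<Longrightarrow> Cod C f = Y"
  by (auto simp: Hom_def)

lemma ArrHom: "f \<in> Arr C \<Longrightarrow> f \<in> Hom C (Dom C f) (Cod C f)"
  by (auto simp: Hom_def)

lemma (in category) Hom_Obj: "f \<in> Hom C X Y \<Longrightarrow> X \<in> Obj C" "f \<in> Hom C X Y \<Longrightarrow> Y \<in> Obj C"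
  using Dom_closed Cod_closed by (auto simp: Hom_def)

lemma (in cat_functor) fobj_Obj: "X \<in> Obj C \<Longrightarrow> fobj F X \<in> Obj D"
  using fobj_closed by auto

context posetal_fibration
begin

abbreviation "over X Y u \<equiv> \<exists>f\<in>Hom E X Y. farr p f = u"

lemma cartesianD:
  assumes "cartesian E B p c" "g \<in> Hom E Z (Cod E c)" "w \<in> Hom B (fobj p Z) (fobj p (Dom E c))"
    "farr p g = farr p c \<cdot>\<^bsub>B\<^esub> w"
  shows "\<exists>h. h \<in> Hom E Z (Dom E c) \<and> farr p h = w \<and> c \<cdot>\<^bsub>E\<^esub> h = g"
proof -
  have "Z \<in> Obj E" using assms(2) p.C.Hom_Obj by blast
  then show ?thesis using assms unfolding cartesian_def by blast
qed

lemma faithful: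
  assumes f: "f \<in> Hom E X Y" and g: "g \<in> Hom E X Y" and e: "farr p f = farr p g"
  shows "f = g"
proof -
  have X: "X \<in> Obj E" and Y: "Y \<in> Obj E" using f p.C.Hom_Obj by blast+
  have u: "farr p f \<in> Hom B (fobj p X) (fobj p Y)" using p.farr_closed f by blast
  obtain c where c: "cartesian E B p c" "Cod E c = Y" "farr p c = farr p f"
    using cartesian_lift[OF Y u] by blast
  have cA: "c \<in> Hom E (Dom E c) Y" using c by (auto simp: cartesian_def Hom_def)
  have "farr p c \<in> Hom B (fobj p (Dom E c)) (fobj p Y)" using p.farr_closed cA by blast
  then have d: "fobj p (Dom E c) = fobj p X" using u c by (auto simp: Hom_def)
  have i: "Idn B (fobj p X) \<in> Hom B (fobj p X) (fobj p (Dom E c))"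
    using p.D.Idn_closed p.fobj_Obj X d by auto
  have eq: "farr p f = farr p c \<cdot>\<^bsub>B\<^esub> Idn B (fobj p X)" using p.D.Idn_right u c by auto
  obtain h where h: "h \<in> Hom E X (Dom E c)" "farr p h = Idn B (fobj p X)" "c \<cdot>\<^bsub>E\<^esub> h = f"
    using cartesianD[OF c(1) _ i eq] f c by auto
  obtain k where k: "k \<in> Hom E X (Dom E c)" "farr p k = Idn B (fobj p X)" "c \<cdot>\<^bsub>E\<^esub> k = g"
    using cartesianD[OF c(1) _ i, of g] eq e g c(2) by auto
  have "h = k" using fibre_thin[OF p.fobj_Obj[OF X] h(1) k(1) h(2) k(2)] .
  then show ?thesis using h k by auto
qed

lemma over_dom: "\<lbrakk>over X Y u\<rbrakk> \<Longrightarrow> u \<in> Hom B (fobj p X) (fobj p Y)"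
  using p.farr_closed by blast

lemma over_comp: "\<lbrakk>over X Y u; over Y Z v\<rbrakk> \<Longrightarrow> over X Z (v \<cdot>\<^bsub>B\<^esub> u)"
  using p.farr_Cmp p.C.Cmp_closed by metis

lemma over_id: "X \<in> Obj E \<Longrightarrow> over X X (Idn B (fobj p X))"
  using p.farr_Idn p.C.Idn_closed by metis

lemma antisym:
  assumes "over X Y (Idn B (fobj p X))" "over Y X (Idn B (fobj p X))"
  shows "X = Y"
proof -
  have X: "X \<in> Obj E" and Y: "Y \<in> Obj E" using assms p.C.Hom_Obj by blast+
  have I: "fobj p X \<in> Obj B" using X p.fobj_Obj by blast
  then have e: "fobj p Y = fobj p X"
    using over_dom[OF assms(1)] p.D.Idn_closed[OF I] by (auto simp: Hom_def)
  interpret F: partial_order "fibre E B p (fobj p X)" using fibre_order I by blast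
  show ?thesis using F.le_antisym[of X Y] X Y e assms by (simp add: fibre_def)
qed

lemma reindex_cart:
  assumes u: "u \<in> Hom B I (fobj p Y)" and Y: "Y \<in> Obj E"
  shows "\<exists>c. cartesian E B p c \<and> c \<in> Hom E (reindex E B p u Y) Y \<and> farr p c = u
     \<and> fobj p (reindex E B p u Y) = I \<and> reindex E B p u Y \<in> Obj E"
proof -
  obtain c where c: "cartesian E B p c" "Cod E c = Y" "farr p c = u"
    using cartesian_lift[OF Y u] by blast
  have cH: "\<And>d. cartesian E B p d \<Longrightarrow> Cod E d = Y \<Longrightarrow> farr p d = u \<Longrightarrow>
      d \<in> Hom E (Dom E d) Y \<and> fobj p (Dom E d) = I \<and> Dom E d \<in> Obj E" 
  proof -
    fix d assume d: "cartesian E B p d" "Cod E d = Y" "farr p d = u"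
    then have H: "d \<in> Hom E (Dom E d) Y" by (auto simp: cartesian_def Hom_def)
    moreover have "farr p d \<in> Hom B (fobj p (Dom E d)) (fobj p Y)" using p.farr_closed H by blast
    ultimately show "d \<in> Hom E (Dom E d) Y \<and> fobj p (Dom E d) = I \<and> Dom E d \<in> Obj E" 
      using u d p.C.Hom_Obj by (auto simp: Hom_def)
  qed
  have I: "I \<in> Obj B" using u p.D.Hom_Obj by blast
  have vert: "over (Dom E d) (Dom E c') (Idn B I)" if c: "cartesian E B p c'" "Cod E c' = Y" "farr p c' = u"
    and d: "cartesian E B p d" "Cod E d = Y" "farr p d = u" for c' d
  proof -
    have "Idn B I \<in> Hom B (fobj p (Dom E d)) (fobj p (Dom E c'))" 
      using p.D.Idn_closed[OF I] cH[OF c] cH[OF d] by simp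
    from cartesianD[OF c(1) _ this, of d] show ?thesis
      using cH[OF c] cH[OF d] c d p.D.Idn_right[OF u] by auto
  qed
  have uniq: "Dom E d = Dom E c" if d: "cartesian E B p d" "Cod E d = Y" "farr p d = u" for d
    using antisym[of "Dom E d" "Dom E c"] vert[OF d c] vert[OF c d] cH[OF d] by auto
  have r: "reindex E B p u Y = Dom E c" unfolding reindex_def
    by (rule the_equality) (use c uniq in blast)+
  show ?thesis unfolding r using c cH[OF c] by blast
qed

lemma over_reindex:
  assumes u: "u \<in> Hom B J (fobj p Y)" and Y: "Y \<in> Obj E" and X: "X \<in> Obj E" and w: "w \<in> Hom B (fobj p X) J"
  shows "over X (reindex E B p u Y) w \<longleftrightarrow> over X Y (u \<cdot>\<^bsub>B\<^esub> w)"
proof -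
  obtain c where c: "cartesian E B p c" "c \<in> Hom E (reindex E B p u Y) Y" "farr p c = u"
     "fobj p (reindex E B p u Y) = J" "reindex E B p u Y \<in> Obj E" using reindex_cart[OF u Y] by blast
  show ?thesis
  proof
    assume "over X (reindex E B p u Y) w" then show "over X Y (u \<cdot>\<^bsub>B\<^esub> w)"
      using over_comp c by blast
  next
    assume "over X Y (u \<cdot>\<^bsub>B\<^esub> w)"
    then obtain g where g: "g \<in> Hom E X Y" "farr p g = u \<cdot>\<^bsub>B\<^esub> w" by blast
    then show "over X (reindex E B p u Y) w"
      using cartesianD[OF c(1), of g X w] c w HomD[OF c(2)] by auto
  qed
qed

lemma arrow_over:
  assumes "over X Y u"
  shows "arrow_over E p X Y u \<in> Hom E X Y" "farr p (arrow_over E p X Y u) = u"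
proof -
  have "\<exists>!f. f \<in> Hom E X Y \<and> farr p f = u" using assms faithful by auto
  from theI'[OF this] show "arrow_over E p X Y u \<in> Hom E X Y" "farr p (arrow_over E p X Y u) = u"
    unfolding arrow_over_def by auto
qed

theorem lift_partial_order: "partial_order (lift_order E B p T)" (is "partial_order ?L")
proof -
  have le_id: "over (fobj T1 Y) (fobj T1 Y) (Idn B (fobj T (fobj p Y)))"
    if "T1 \<in> Lift E B p T" "Y \<in> Obj E" for T1 Y
  proof -
    have "fobj T1 Y \<in> Obj E" "fobj p (fobj T1 Y) = fobj T (fobj p Y)" using that
      by (auto simp: Lift_def cat_monad_def cat_functor.fobj_Obj)
    then show ?thesis using over_id by metis
  qed
  have anti: "T1 = T2" if T: "T1 \<in> Lift E B p T" "T2 \<in> Lift E B p T" 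
    and le: "\<And>Y. Y \<in> Obj E \<Longrightarrow> over (fobj T1 Y) (fobj T2 Y) (Idn B (fobj T (fobj p Y)))"
     "\<And>Y. Y \<in> Obj E \<Longrightarrow> over (fobj T2 Y) (fobj T1 Y) (Idn B (fobj T (fobj p Y)))" for T1 T2
  proof -
    interpret T1: cat_monad E T1 using T by (auto simp: Lift_def)
    interpret T2: cat_monad E T2 using T by (auto simp: Lift_def)
    have o: "fobj T1 Y = fobj T2 Y" if "Y \<in> Obj E" for Y
      using antisym[of "fobj T1 Y" "fobj T2 Y"] le[OF that] T that by (auto simp: Lift_def)
    have 1: "fobj T1 = fobj T2" using T1.fobj_closed T2.fobj_closed o by (meson PiE_ext)
    have 2: "farr T1 = farr T2" 
    proof (rule extensionalityI[OF T1.farr_ext T2.farr_ext])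
      fix f assume f: "f \<in> Arr E"
      have "farr p (farr T1 f) = farr p (farr T2 f)" using T f by (auto simp: Lift_def)
      then show "farr T1 f = farr T2 f" using faithful T1.farr_closed[OF ArrHom[OF f]] T2.farr_closed[OF ArrHom[OF f]] 1
        by metis
    qed
    have 3: "munit T1 = munit T2" 
    proof (rule extensionalityI[OF T1.munit_ext T2.munit_ext])
      fix f assume f: "f \<in> Obj E"
      have "farr p (munit T1 f) = farr p (munit T2 f)" using T f by (auto simp: Lift_def)
      then show "munit T1 f = munit T2 f" using faithful T1.munit_closed[OF f] T2.munit_closed[OF f] 1
        by metis
    qed
    have 4: "mmult T1 = mmult T2" 
    proof (rule extensionalityI[OF T1.mmult_ext T2.mmult_ext])
      fix f assume f: "f \<in> Obj E"
      have "farr p (mmult T1 f) = farr p (mmult T2 f)" using T f by (auto simp: Lift_def)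
      then show "mmult T1 f = mmult T2 f" using faithful T1.mmult_closed[OF f] T2.mmult_closed[OF f] 1
        by metis
    qed
    show ?thesis using 1 2 3 4 by simp
  qed
  have tr: "over (fobj T1 Y) (fobj T3 Y) (Idn B (fobj T (fobj p Y)))"
    if T: "T1 \<in> Lift E B p T" "Y \<in> Obj E" "over (fobj T1 Y) (fobj T2 Y) (Idn B (fobj T (fobj p Y)))"
     "over (fobj T2 Y) (fobj T3 Y) (Idn B (fobj T (fobj p Y)))" for T1 T2 T3 Y
  proof -
    have "fobj T1 Y \<in> Obj E" "fobj p (fobj T1 Y) = fobj T (fobj p Y)" using that
      by (auto simp: Lift_def cat_monad_def cat_functor.fobj_Obj)
    then have "fobj T (fobj p Y) \<in> Obj B" using p.fobj_Obj by metis
    then have "Idn B (fobj T (fobj p Y)) \<cdot>\<^bsub>B\<^esub> Idn B (fobj T (fobj p Y)) = Idn B (fobj T (fobj p Y))"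
      using p.D.Idn_closed p.D.Idn_left by blast
    then show ?thesis using over_comp[OF that(3,4)] by simp
  qed
  show ?thesis
  proof unfold_locales
    fix x y z assume "x \<sqsubseteq>\<^bsub>?L\<^esub> y" "y \<sqsubseteq>\<^bsub>?L\<^esub> z" "x \<in> carrier ?L" "y \<in> carrier ?L" "z \<in> carrier ?L"
    then show "x \<sqsubseteq>\<^bsub>?L\<^esub> z" using tr[of x _ y z] by (simp add: lift_order_def fibre_def)
  qed (use le_id anti in \<open>auto simp: lift_order_def fibre_def\<close>)
qed

lemma lifting_of_Lift:
  assumes T: "cat_monad B T"
    and G: "\<And>Y. Y \<in> Obj E \<Longrightarrow> G Y \<in> Obj E \<and> fobj p (G Y) = fobj T (fobj p Y)"
    and F: "\<And>X Y f. f \<in> Hom E X Y \<Longrightarrow> over (G X) (G Y) (farr T (farr p f))"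
    and U: "\<And>Y. Y \<in> Obj E \<Longrightarrow> over Y (G Y) (munit T (fobj p Y))"
    and M: "\<And>Y. Y \<in> Obj E \<Longrightarrow> over (G (G Y)) (G Y) (mmult T (fobj p Y))"
  shows "lifting_of E p T G \<in> Lift E B p T"
proof -
  interpret T: cat_monad B T by fact
  let ?L = "lifting_of E p T G"
  have o: "Y \<in> Obj E \<Longrightarrow> fobj ?L Y = G Y" for Y by (simp add: lifting_of_def)
  have a: "farr ?L f \<in> Hom E (G X) (G Y) \<and> farr p (farr ?L f) = farr T (farr p f)" if "f \<in> Hom E X Y" for f X Y
    using arrow_over[OF F[OF that]] that by (auto simp: lifting_of_def Hom_def)
  have u: "munit ?L Y \<in> Hom E Y (G Y) \<and> farr p (munit ?L Y) = munit T (fobj p Y)" if "Y \<in> Obj E" for Y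
    using arrow_over[OF U[OF that]] that by (auto simp: lifting_of_def)
  have m: "mmult ?L Y \<in> Hom E (G (G Y)) (G Y) \<and> farr p (mmult ?L Y) = mmult T (fobj p Y)" if "Y \<in> Obj E" for Y
    using arrow_over[OF M[OF that]] that by (auto simp: lifting_of_def)
  note ob = p.C.Hom_Obj p.fobj_Obj
  have cl: "h \<cdot>\<^bsub>E\<^esub> g \<in> Hom E X Z" "farr p (h \<cdot>\<^bsub>E\<^esub> g) = farr p h \<cdot>\<^bsub>B\<^esub> farr p g" 
    if "g \<in> Hom E X Y" "h \<in> Hom E Y Z" for g h X Y Z
    using that p.C.Cmp_closed p.farr_Cmp by blast+
  have idc: "Idn E X \<in> Hom E X X" "farr p (Idn E X) = Idn B (fobj p X)" if "X \<in> Obj E" for X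
    using that p.C.Idn_closed p.farr_Idn by blast+
  note a1 = a[THEN conjunct1] and a2 = a[THEN conjunct2] and u1 = u[THEN conjunct1] and u2 = u[THEN conjunct2]
    and m1 = m[THEN conjunct1] and m2 = m[THEN conjunct2]
  have "cat_monad E ?L"
  proof unfold_locales
    show "fobj ?L \<in> Obj E \<rightarrow>\<^sub>E Obj E" using G by (auto simp: lifting_of_def)
    show "farr ?L \<in> extensional (Arr E)" "munit ?L \<in> extensional (Obj E)" "mmult ?L \<in> extensional (Obj E)"
      by (auto simp: lifting_of_def)
  next
    fix f X Y assume f: "f \<in> Hom E X Y"
    have X: "X \<in> Obj E" and Y: "Y \<in> Obj E" using f p.C.Hom_Obj by blast+
    show "farr ?L f \<in> Hom E (fobj ?L X) (fobj ?L Y)" using a1[OF f] o X Y by simp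
    show "farr ?L f \<cdot>\<^bsub>E\<^esub> munit ?L X = munit ?L Y \<cdot>\<^bsub>E\<^esub> f"
      by (rule faithful[OF cl(1)[OF u1[OF X] a1[OF f]] cl(1)[OF f u1[OF Y]]])
        (simp only: cl(2)[OF u1[OF X] a1[OF f]] cl(2)[OF f u1[OF Y]] u2[OF X] u2[OF Y] a2[OF f]
          T.munit_natural[OF p.farr_closed[OF f]])
    show "farr ?L f \<cdot>\<^bsub>E\<^esub> mmult ?L X = mmult ?L Y \<cdot>\<^bsub>E\<^esub> farr ?L (farr ?L f)"
      by (rule faithful[OF cl(1)[OF m1[OF X] a1[OF f]] cl(1)[OF a1[OF a1[OF f]] m1[OF Y]]])
        (simp only: cl(2)[OF m1[OF X] a1[OF f]] cl(2)[OF a1[OF a1[OF f]] m1[OF Y]] m2[OF X] m2[OF Y] a2[OF f] a2[OF a1[OF f]]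
          T.mmult_natural[OF p.farr_closed[OF f]])
  next
    fix X assume X: "X \<in> Obj E"
    have GX: "G X \<in> Obj E" "fobj p (G X) = fobj T (fobj p X)" using G X by auto
    have pX: "fobj p X \<in> Obj B" using X p.fobj_Obj by auto
    show "farr ?L (Idn E X) = Idn E (fobj ?L X)" unfolding o[OF X]
      by (rule faithful[OF a1[OF idc(1)[OF X]] idc(1)[OF GX(1)]])
        (simp only: a2[OF idc(1)[OF X]] idc(2)[OF X] idc(2)[OF GX(1)] GX(2) T.farr_Idn[OF pX])
    show "munit ?L X \<in> Hom E X (fobj ?L X)" "mmult ?L X \<in> Hom E (fobj ?L (fobj ?L X)) (fobj ?L X)"
      using u1 m1 o X GX by auto
    show "mmult ?L X \<cdot>\<^bsub>E\<^esub> munit ?L (fobj ?L X) = Idn E (fobj ?L X)" unfolding o[OF X]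
      by (rule faithful[OF cl(1)[OF u1[OF GX(1)] m1[OF X]] idc(1)[OF GX(1)]])
        (simp only: cl(2)[OF u1[OF GX(1)] m1[OF X]] u2[OF GX(1)] m2[OF X] idc(2)[OF GX(1)] GX(2) T.mmult_munit[OF pX])
    show "mmult ?L X \<cdot>\<^bsub>E\<^esub> farr ?L (munit ?L X) = Idn E (fobj ?L X)" unfolding o[OF X]
      by (rule faithful[OF cl(1)[OF a1[OF u1[OF X]] m1[OF X]] idc(1)[OF GX(1)]])
        (simp only: cl(2)[OF a1[OF u1[OF X]] m1[OF X]] a2[OF u1[OF X]] u2[OF X] m2[OF X] idc(2)[OF GX(1)] GX(2) T.mmult_farr_munit[OF pX])
    show "mmult ?L X \<cdot>\<^bsub>E\<^esub> mmult ?L (fobj ?L X) = mmult ?L X \<cdot>\<^bsub>E\<^esub> farr ?L (mmult ?L X)" unfolding o[OF X]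
      by (rule faithful[OF cl(1)[OF m1[OF GX(1)] m1[OF X]] cl(1)[OF a1[OF m1[OF X]] m1[OF X]]])
        (simp only: cl(2)[OF m1[OF GX(1)] m1[OF X]] cl(2)[OF a1[OF m1[OF X]] m1[OF X]] a2[OF m1[OF X]] m2[OF GX(1)] m2[OF X] GX(2) T.mmult_assoc[OF pX])
  next
    fix f g X Y Z assume f: "f \<in> Hom E X Y" and g: "g \<in> Hom E Y Z"
    show "farr ?L (g \<cdot>\<^bsub>E\<^esub> f) = farr ?L g \<cdot>\<^bsub>E\<^esub> farr ?L f"
      by (rule faithful[OF a1[OF cl(1)[OF f g]] cl(1)[OF a1[OF f] a1[OF g]]])
        (simp only: a2[OF cl(1)[OF f g]] cl(2)[OF f g] cl(2)[OF a1[OF f] a1[OF g]] a2[OF f] a2[OF g]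
          T.farr_Cmp[OF p.farr_closed[OF f] p.farr_closed[OF g]])
  qed
  then show ?thesis using G a[OF ArrHom] u m o by (auto simp: Lift_def)
qed

end

context posetal_fibration_limits
begin

lemma fibre_inf:
  assumes "I \<in> Obj B" "A \<subseteq> carrier (fibre E B p I)"
  shows "is_glb (fibre E B p I) (\<Sqinter>\<^bsub>fibre E B p I\<^esub> A) A"
  unfolding inf_def using someI_ex[OF fibre_meets[OF assms]] .

lemma over_inf:
  assumes A: "A \<subseteq> carrier (fibre E B p J)" and X: "X \<in> Obj E" and w: "w \<in> Hom B (fobj p X) J"
  shows "over X (\<Sqinter>\<^bsub>fibre E B p J\<^esub> A) w \<longleftrightarrow> (\<forall>a\<in>A. over X a w)"
proof -
  have J: "J \<in> Obj B" using w p.D.Hom_Obj by blast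
  have I: "fobj p X \<in> Obj B" using X p.fobj_Obj by blast
  let ?M = "\<Sqinter>\<^bsub>fibre E B p J\<^esub> A"
  have g: "is_glb (fibre E B p J) ?M A" using fibre_inf[OF J A] .
  have M: "?M \<in> Obj E" "fobj p ?M = J" using g by (auto simp: greatest_def Lower_def fibre_def)
  have r: "is_glb (fibre E B p (fobj p X)) (reindex E B p w ?M) (reindex E B p w ` A)"
    using reindex_meets[OF w A g] .
  have key: "over X a w \<longleftrightarrow> over X (reindex E B p w a) (Idn B (fobj p X))" 
     "reindex E B p w a \<in> carrier (fibre E B p (fobj p X))" if "a \<in> Obj E" "fobj p a = J" for a
    using over_reindex[of w "fobj p X" a X "Idn B (fobj p X)"] that w X p.D.Idn_closed[OF I] p.D.Idn_right[OF w]
     reindex_cart[of w "fobj p X" a] by (auto simp: fibre_def)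
  have A': "a \<in> A \<Longrightarrow> a \<in> Obj E \<and> fobj p a = J" for a using A by (auto simp: fibre_def)
  interpret P: partial_order "fibre E B p (fobj p X)" using fibre_order I by blast
  have "over X ?M w \<longleftrightarrow> X \<sqsubseteq>\<^bsub>fibre E B p (fobj p X)\<^esub> reindex E B p w ?M"
    using key[OF M] by (simp add: fibre_def)
  also have "\<dots> \<longleftrightarrow> (\<forall>b \<in> reindex E B p w ` A. X \<sqsubseteq>\<^bsub>fibre E B p (fobj p X)\<^esub> b)"
  proof
    assume "X \<sqsubseteq>\<^bsub>fibre E B p (fobj p X)\<^esub> reindex E B p w ?M"
    moreover have "X \<in> carrier (fibre E B p (fobj p X))" using X by (simp add: fibre_def)
    moreover have "b \<in> carrier (fibre E B p (fobj p X))" "reindex E B p w ?M \<sqsubseteq>\<^bsub>fibre E B p (fobj p X)\<^esub> b" if "b \<in> reindex E B p w ` A" for b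
      using that key A' r by (auto simp: greatest_def Lower_def)
    ultimately show "\<forall>b \<in> reindex E B p w ` A. X \<sqsubseteq>\<^bsub>fibre E B p (fobj p X)\<^esub> b"
      using P.le_trans key(2)[OF M] by blast
  next
    assume "\<forall>b \<in> reindex E B p w ` A. X \<sqsubseteq>\<^bsub>fibre E B p (fobj p X)\<^esub> b"
    moreover have "X \<in> carrier (fibre E B p (fobj p X))" using X by (simp add: fibre_def)
    ultimately have "X \<in> Lower (fibre E B p (fobj p X)) (reindex E B p w ` A)" by (auto simp: Lower_def)
    then show "X \<sqsubseteq>\<^bsub>fibre E B p (fobj p X)\<^esub> reindex E B p w ?M" using r by (auto simp: greatest_def)
  qed
  also have "\<dots> \<longleftrightarrow> (\<forall>a\<in>A. over X a w)" using key A' by (simp add: fibre_def)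
  finally show ?thesis .
qed

lemma inf_closed:
  assumes "I \<in> Obj B" "A \<subseteq> carrier (fibre E B p I)"
  shows "\<Sqinter>\<^bsub>fibre E B p I\<^esub> A \<in> Obj E" "fobj p (\<Sqinter>\<^bsub>fibre E B p I\<^esub> A) = I"
  using fibre_inf[OF assms] by (auto simp: greatest_def Lower_def fibre_def)

theorem
  assumes T: "cat_monad B T" and R: "R \<in> Obj B" and S: "S \<in> Obj E" "fobj p S = fobj T R"
  shows codensity_lifting_Lift: "codensity_lifting E B p T R S \<in> Lift E B p T" 
    and over_codensity: "\<And>X Y w. \<lbrakk>X \<in> Obj E; Y \<in> Obj E; w \<in> Hom B (fobj p X) (fobj T (fobj p Y))\<rbrakk> \<Longrightarrow>
      over X (fobj (codensity_lifting E B p T R S) Y) w \<longleftrightarrow>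
      (\<forall>f\<in>Hom E Y S. over X S (kleisli_ext B T R (farr p f) \<cdot>\<^bsub>B\<^esub> w))"
proof -
  interpret T: cat_monad B T by fact
  let ?A = "\<lambda>Y. (\<lambda>f. reindex E B p (kleisli_ext B T R (farr p f)) S) ` Hom E Y S"
  define G0 where "G0 = (\<lambda>Y. \<Sqinter>\<^bsub>fibre E B p (fobj T (fobj p Y))\<^esub> (?A Y))"
  have ke: "kleisli_ext B T R u \<in> Hom B (fobj T I) (fobj T R)" if "u \<in> Hom B I (fobj T R)" for u I
    using that T.farr_closed T.mmult_closed[OF R] p.D.Cmp_closed unfolding kleisli_ext_def by blast
  have kf: "kleisli_ext B T R (farr p f) \<in> Hom B (fobj T (fobj p Y)) (fobj p S)" if "f \<in> Hom E Y S" for f Y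
    using ke p.farr_closed[OF that] S by auto
  have A: "?A Y \<subseteq> carrier (fibre E B p (fobj T (fobj p Y)))" for Y
    using reindex_cart[OF kf S(1)] by (fastforce simp: fibre_def)
  have tp: "Y \<in> Obj E \<Longrightarrow> fobj T (fobj p Y) \<in> Obj B" for Y using p.fobj_Obj T.fobj_Obj by blast
  have G: "Y \<in> Obj E \<Longrightarrow> G0 Y \<in> Obj E \<and> fobj p (G0 Y) = fobj T (fobj p Y)" for Y
    unfolding G0_def using inf_closed[OF tp A] by blast
  have ov: "over X (G0 Y) w \<longleftrightarrow> (\<forall>f\<in>Hom E Y S. over X S (kleisli_ext B T R (farr p f) \<cdot>\<^bsub>B\<^esub> w))"
    if "X \<in> Obj E" "Y \<in> Obj E" "w \<in> Hom B (fobj p X) (fobj T (fobj p Y))" for X Y w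
    unfolding G0_def using over_inf[OF A that(1,3)] over_reindex[OF kf S(1) that(1,3)] by auto
  have base: "over (G0 Y) S (kleisli_ext B T R (farr p f))" if f: "f \<in> Hom E Y S" for f Y
  proof -
    have Y: "Y \<in> Obj E" using f p.C.Hom_Obj by blast
    have i: "Idn B (fobj T (fobj p Y)) \<in> Hom B (fobj p (G0 Y)) (fobj T (fobj p Y))"
      using G[OF Y] p.D.Idn_closed[OF tp[OF Y]] by simp
    have "over (G0 Y) (G0 Y) (Idn B (fobj T (fobj p Y)))" using over_id[of "G0 Y"] G[OF Y] by simp
    then have "over (G0 Y) S (kleisli_ext B T R (farr p f) \<cdot>\<^bsub>B\<^esub> Idn B (fobj T (fobj p Y)))"
      using ov[OF conjunct1[OF G[OF Y]] Y i] f by blast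
    then show ?thesis using p.D.Idn_right[OF kf[OF f]] by simp
  qed
  have comp: "kleisli_ext B T R v \<cdot>\<^bsub>B\<^esub> farr T u = kleisli_ext B T R (v \<cdot>\<^bsub>B\<^esub> u)" 
    if "u \<in> Hom B I J" "v \<in> Hom B J (fobj T R)" for u v I J
    unfolding kleisli_ext_def using T.farr_Cmp[OF that] 
      p.D.Cmp_assoc[OF T.farr_closed[OF that(1)] T.farr_closed[OF that(2)] T.mmult_closed[OF R]] by simp
  have L: "lifting_of E p T G0 \<in> Lift E B p T"
  proof (rule lifting_of_Lift[OF T G])
    fix X Y f assume f: "f \<in> Hom E X Y"
    have X: "X \<in> Obj E" "Y \<in> Obj E" using f p.C.Hom_Obj by blast+
    have w: "farr T (farr p f) \<in> Hom B (fobj p (G0 X)) (fobj T (fobj p Y))"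
      using G[OF X(1)] T.farr_closed[OF p.farr_closed[OF f]] by simp
    have "over (G0 X) S (kleisli_ext B T R (farr p g) \<cdot>\<^bsub>B\<^esub> farr T (farr p f))" if g: "g \<in> Hom E Y S" for g
      using comp[OF p.farr_closed[OF f], of "farr p g"] p.farr_closed[OF g] S p.farr_Cmp[OF f g] base[OF p.C.Cmp_closed[OF f g]] by auto
    then show "over (G0 X) (G0 Y) (farr T (farr p f))" using ov[OF _ X(2) w] G[OF X(1)] by blast
  next
    fix Y assume Y: "Y \<in> Obj E"
    have pY: "fobj p Y \<in> Obj B" using Y p.fobj_Obj by blast
    have "kleisli_ext B T R (farr p g) \<cdot>\<^bsub>B\<^esub> munit T (fobj p Y) = farr p g" if g: "g \<in> Hom E Y S" for g
    proof -
      have pg: "farr p g \<in> Hom B (fobj p Y) (fobj T R)" using p.farr_closed[OF g] S by simp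
      have "kleisli_ext B T R (farr p g) \<cdot>\<^bsub>B\<^esub> munit T (fobj p Y) = mmult T R \<cdot>\<^bsub>B\<^esub> (farr T (farr p g) \<cdot>\<^bsub>B\<^esub> munit T (fobj p Y))"
        unfolding kleisli_ext_def using p.D.Cmp_assoc[OF T.munit_closed[OF pY] T.farr_closed[OF pg] T.mmult_closed[OF R]] by simp
      also have "\<dots> = mmult T R \<cdot>\<^bsub>B\<^esub> (munit T (fobj T R) \<cdot>\<^bsub>B\<^esub> farr p g)" using T.munit_natural[OF pg] by simp
      also have "\<dots> = farr p g" using p.D.Cmp_assoc[OF pg T.munit_closed[OF T.fobj_Obj[OF R]] T.mmult_closed[OF R]]
         T.mmult_munit[OF R] p.D.Idn_left[OF pg] by simp
      finally show ?thesis .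
    qed
    then show "over Y (G0 Y) (munit T (fobj p Y))" using ov[OF Y Y] T.munit_closed[OF pY] by auto
    have w: "mmult T (fobj p Y) \<in> Hom B (fobj p (G0 (G0 Y))) (fobj T (fobj p Y))"
      using T.mmult_closed[OF pY] G Y by auto
    have "over (G0 (G0 Y)) S (kleisli_ext B T R (farr p g) \<cdot>\<^bsub>B\<^esub> mmult T (fobj p Y))" if g: "g \<in> Hom E Y S" for g
    proof -
      have pg: "farr p g \<in> Hom B (fobj p Y) (fobj T R)" using p.farr_closed[OF g] S by simp
      obtain h where h: "h \<in> Hom E (G0 Y) S" "farr p h = kleisli_ext B T R (farr p g)" using base[OF g] by blast
      have "kleisli_ext B T R (farr p g) \<cdot>\<^bsub>B\<^esub> mmult T (fobj p Y) = mmult T R \<cdot>\<^bsub>B\<^esub> (farr T (farr p g) \<cdot>\<^bsub>B\<^esub> mmult T (fobj p Y))"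
        unfolding kleisli_ext_def using p.D.Cmp_assoc[OF T.mmult_closed[OF pY] T.farr_closed[OF pg] T.mmult_closed[OF R]] by simp
      also have "\<dots> = mmult T R \<cdot>\<^bsub>B\<^esub> (mmult T (fobj T R) \<cdot>\<^bsub>B\<^esub> farr T (farr T (farr p g)))" using T.mmult_natural[OF pg] by simp
      also have "\<dots> = (mmult T R \<cdot>\<^bsub>B\<^esub> farr T (mmult T R)) \<cdot>\<^bsub>B\<^esub> farr T (farr T (farr p g))" 
        using p.D.Cmp_assoc[OF T.farr_closed[OF T.farr_closed[OF pg]] T.mmult_closed[OF T.fobj_Obj[OF R]] T.mmult_closed[OF R]]
         T.mmult_assoc[OF R] by simp
      also have "\<dots> = kleisli_ext B T R (kleisli_ext B T R (farr p g))"
        using p.D.Cmp_assoc[OF T.farr_closed[OF T.farr_closed[OF pg]] T.farr_closed[OF T.mmult_closed[OF R]] T.mmult_closed[OF R]]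
          T.farr_Cmp[OF T.farr_closed[OF pg] T.mmult_closed[OF R]] by (simp add: kleisli_ext_def)
      finally show ?thesis using base[OF h(1)] h(2) by simp
    qed
    then show "over (G0 (G0 Y)) (G0 Y) (mmult T (fobj p Y))" using ov[OF _ Y w] G Y by blast
  qed
  have eq: "codensity_lifting E B p T R S = lifting_of E p T G0" unfolding codensity_lifting_def infi_def G0_def ..
  show "codensity_lifting E B p T R S \<in> Lift E B p T" using L eq by simp
  fix X Y w assume "X \<in> Obj E" "Y \<in> Obj E" "w \<in> Hom B (fobj p X) (fobj T (fobj p Y))"
  from ov[OF this] show "over X (fobj (codensity_lifting E B p T R S) Y) w \<longleftrightarrow>
      (\<forall>f\<in>Hom E Y S. over X S (kleisli_ext B T R (farr p f) \<cdot>\<^bsub>B\<^esub> w))" 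
    unfolding eq using \<open>Y \<in> Obj E\<close> by (simp add: lifting_of_def)
qed

theorem lift_order_meet:
  assumes T: "cat_monad B T" and A: "A \<subseteq> Lift E B p T"
  shows "is_glb (lift_order E B p T)
    (lifting_of E p T (\<lambda>Y. IINF\<^bsub>fibre E B p (fobj T (fobj p Y))\<^esub> L:A. fobj L Y)) A"
proof -
  interpret T: cat_monad B T by fact
  define G where "G = (\<lambda>Y. \<Sqinter>\<^bsub>fibre E B p (fobj T (fobj p Y))\<^esub> ((\<lambda>L. fobj L Y) ` A))"
  have tp: "fobj T (fobj p Y) \<in> Obj B" if "Y \<in> Obj E" for Y using that p.fobj_Obj T.fobj_Obj by blast
  have AM: "cat_monad E L" if "L \<in> A" for L using A that by (auto simp: Lift_def)
  have L: "fobj L Y \<in> Obj E" "fobj p (fobj L Y) = fobj T (fobj p Y)" if "L \<in> A" "Y \<in> Obj E" for L Y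
    using A that by (auto simp: Lift_def cat_monad_def cat_functor.fobj_Obj)
  have AY: "(\<lambda>L. fobj L Y) ` A \<subseteq> carrier (fibre E B p (fobj T (fobj p Y)))" if "Y \<in> Obj E" for Y
    using L that by (auto simp: fibre_def)
  have GG: "G Y \<in> Obj E" "fobj p (G Y) = fobj T (fobj p Y)" if "Y \<in> Obj E" for Y
    unfolding G_def using inf_closed[OF tp AY] that by blast+
  have ov: "over X (G Y) w \<longleftrightarrow> (\<forall>L\<in>A. over X (fobj L Y) w)"
    if "X \<in> Obj E" "Y \<in> Obj E" "w \<in> Hom B (fobj p X) (fobj T (fobj p Y))" for X Y w
    unfolding G_def using over_inf[OF AY[OF that(2)] that(1,3)] by blast
  have below: "over (G Y) (fobj L Y) (Idn B (fobj T (fobj p Y)))" if "L \<in> A" "Y \<in> Obj E" for L Y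
    using ov[OF GG(1) that(2)] over_id[OF GG(1)] GG(2) p.D.Idn_closed[OF tp] that by metis
  have down: "over (G Y) Z w" if "L \<in> A" "Y \<in> Obj E" "over (fobj L Y) Z w" for L Y Z w
  proof -
    have w: "w \<in> Hom B (fobj T (fobj p Y)) (fobj p Z)" using over_dom[OF that(3)] L(2) that by simp
    show ?thesis using over_comp[OF below[OF that(1,2)] that(3)] p.D.Idn_right[OF w] by simp
  qed
  have G: "lifting_of E p T G \<in> Lift E B p T"
  proof (rule lifting_of_Lift[OF T])
    fix Y assume Y: "Y \<in> Obj E"
    show "G Y \<in> Obj E \<and> fobj p (G Y) = fobj T (fobj p Y)" using GG[OF Y] by blast
    have pY: "fobj p Y \<in> Obj B" using Y p.fobj_Obj by blast
    show "over Y (G Y) (munit T (fobj p Y))" unfolding ov[OF Y Y T.munit_closed[OF pY]]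
    proof
      fix L assume "L \<in> A"
      then show "over Y (fobj L Y) (munit T (fobj p Y))"
        using cat_monad.munit_closed[OF AM Y] A Y by (auto simp: Lift_def)
    qed
    have w: "mmult T (fobj p Y) \<in> Hom B (fobj p (G (G Y))) (fobj T (fobj p Y))"
      using T.mmult_closed[OF pY] GG(2)[OF Y] GG(2)[OF GG(1)[OF Y]] by simp
    show "over (G (G Y)) (G Y) (mmult T (fobj p Y))"
      unfolding ov[OF GG(1)[OF GG(1)[OF Y]] Y w]
    proof
      fix L assume LA: "L \<in> A"
      interpret L: cat_monad E L using AM LA .
      obtain b where b: "b \<in> Hom E (G Y) (fobj L Y)" "farr p b = Idn B (fobj T (fobj p Y))"
        using below[OF LA Y] by blast
      have bA: "b \<in> Arr E" using b(1) by (simp add: Hom_def)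
      have Lb: "farr L b \<in> Hom E (fobj L (G Y)) (fobj L (fobj L Y))" using L.farr_closed[OF b(1)] .
      have "farr p (farr L b) = farr T (Idn B (fobj T (fobj p Y)))"
        using A LA bA b(2) by (auto simp: Lift_def)
      then have pb: "farr p (farr L b) = Idn B (fobj T (fobj T (fobj p Y)))"
        using T.farr_Idn[OF tp[OF Y]] by simp
      have pm: "farr p (mmult L Y) = mmult T (fobj p Y)" using A LA Y by (auto simp: Lift_def)
      have "over (fobj L (G Y)) (fobj L Y) (mmult T (fobj p Y) \<cdot>\<^bsub>B\<^esub> Idn B (fobj T (fobj T (fobj p Y))))"
        using over_comp[of "fobj L (G Y)" "fobj L (fobj L Y)" _ "fobj L Y"] Lb pb L.mmult_closed[OF Y] pm by blast
      then have "over (fobj L (G Y)) (fobj L Y) (mmult T (fobj p Y))"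
        using p.D.Idn_right[OF T.mmult_closed[OF pY]] by simp
      then show "over (G (G Y)) (fobj L Y) (mmult T (fobj p Y))"
        using down[OF LA GG(1)[OF Y]] by blast
    qed
  next
    fix X Y f assume f: "f \<in> Hom E X Y"
    have X: "X \<in> Obj E" and Y: "Y \<in> Obj E" using f p.C.Hom_Obj by blast+
    have w: "farr T (farr p f) \<in> Hom B (fobj p (G X)) (fobj T (fobj p Y))"
      using T.farr_closed[OF p.farr_closed[OF f]] GG(2)[OF X] by simp
    show "over (G X) (G Y) (farr T (farr p f))" unfolding ov[OF GG(1)[OF X] Y w]
    proof
      fix L assume LA: "L \<in> A"
      interpret L: cat_monad E L using AM LA .
      have "farr p (farr L f) = farr T (farr p f)" using A LA HomD(1)[OF f] by (auto simp: Lift_def)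
      then show "over (G X) (fobj L Y) (farr T (farr p f))"
        using down[OF LA X] L.farr_closed[OF f] by blast
    qed
  qed
  have o: "fobj (lifting_of E p T G) Y = G Y" if "Y \<in> Obj E" for Y using that by (simp add: lifting_of_def)
  have "is_glb (lift_order E B p T) (lifting_of E p T G) A"
  proof (rule greatest_LowerI)
    fix L assume "L \<in> A"
    then show "lifting_of E p T G \<sqsubseteq>\<^bsub>lift_order E B p T\<^esub> L"
      using below o by (simp add: lift_order_def fibre_def)
  next
    fix L assume "L \<in> Lower (lift_order E B p T) A"
    then have LL: "L \<in> Lift E B p T"
      and le: "\<And>M Y. \<lbrakk>M \<in> A; Y \<in> Obj E\<rbrakk> \<Longrightarrow> over (fobj L Y) (fobj M Y) (Idn B (fobj T (fobj p Y)))"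
      using A by (auto simp: Lower_def lift_order_def fibre_def)
    have "over (fobj L Y) (G Y) (Idn B (fobj T (fobj p Y)))" if Y: "Y \<in> Obj E" for Y
    proof -
      have LY: "fobj L Y \<in> Obj E" "fobj p (fobj L Y) = fobj T (fobj p Y)"
        using LL Y by (auto simp: Lift_def cat_monad_def cat_functor.fobj_Obj)
      show ?thesis using ov[OF LY(1) Y] LY(2) p.D.Idn_closed[OF tp[OF Y]] le Y by simp
    qed
    then show "L \<sqsubseteq>\<^bsub>lift_order E B p T\<^esub> lifting_of E p T G"
      using o by (simp add: lift_order_def fibre_def)
  qed (use A G in \<open>auto simp: lift_order_def\<close>)
  then show ?thesis unfolding G_def infi_def .
qed

end

end

theory Submission
  imports Defs
begin

text \<open>
  A lifting \<open>T'\<close> is a lower bound of the codensity liftings \<open>[T' X]\<^sup>p\<^sup>X\<close>: for \<open>f : Y \<rightarrow> T' X\<close> the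
  Kleisli extension of \<open>f\<close> with respect to \<open>T'\<close> lies over that of \<open>p f\<close>, so
  \<open>T' Y\<close> is below the reindexing of \<open>T' X\<close> along the latter.  It is the greatest one because the
  meet defining \<open>[T' Y]\<^sup>p\<^sup>Y Y\<close> has an entry for the unit \<open>\<eta> : Y \<rightarrow> T' Y\<close>, whose Kleisli extension
  is the identity; hence \<open>[T' Y]\<^sup>p\<^sup>Y Y \<le> T' Y\<close>.
\<close>

lemma (in cat_monad) kleisli_ext_munit:
  "X \<in> Obj C \<Longrightarrow> kleisli_ext C T X (munit T X) = Idn C (fobj T X)"
  by (simp add: kleisli_ext_def mmult_farr_munit)

lemma (in cat_monad) kleisli_ext_closed:
  "\<lbrakk>R \<in> Obj C; u \<in> Hom C I (fobj T R)\<rbrakk> \<Longrightarrow> kleisli_ext C T R u \<in> Hom C (fobj T I) (fobj T R)"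
  unfolding kleisli_ext_def using C.Cmp_closed farr_closed mmult_closed by blast

context posetal_fibration
begin

text \<open>\<open>p\<close> preserves composition and sends the arrow action and multiplication of
  \<open>T'\<close> to those of \<open>T\<close>. This makes Kleisli extensions in \<open>E\<close>
  witnesses for \<open>over\<close>.\<close>

lemma Lift_kleisli_ext:
  assumes T': "T' \<in> Lift E B p T" and X: "X \<in> Obj E" and f: "f \<in> Hom E Y (fobj T' X)"
  shows "farr p (kleisli_ext E T' X f) = kleisli_ext B T (fobj p X) (farr p f)"
proof -
  interpret T': cat_monad E T' using T' by (simp add: Lift_def)
  show ?thesis
    unfolding kleisli_ext_def
    using p.farr_Cmp[OF T'.farr_closed[OF f] T'.mmult_closed[OF X]] T' X HomD(1)[OF f]
    by (simp add: Lift_def)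
qed

end

context posetal_fibration_limits
begin

lemma Lift_is_glb_codensity:
  assumes T: "cat_monad B T" and T': "T' \<in> Lift E B p T"
  shows "is_glb (lift_order E B p T) T'
    ((\<lambda>X. codensity_lifting E B p T (fobj p X) (fobj T' X)) ` Obj E)"
proof -
  interpret T: cat_monad B T by fact
  interpret T': cat_monad E T' using T' by (simp add: Lift_def)
  let ?K = "\<lambda>X. codensity_lifting E B p T (fobj p X) (fobj T' X)"
  have Lobj: "fobj L X \<in> Obj E" "fobj p (fobj L X) = fobj T (fobj p X)"
    if "L \<in> Lift E B p T" "X \<in> Obj E" for L X
    using that by (auto simp: Lift_def cat_monad_def cat_functor.fobj_Obj)
  \<comment> \<open>This is \<open>over_codensity\<close> with \<open>w\<close> an identity. It
    serves both halves: first with \<open>L = T'\<close>, then with \<open>L\<close> an arbitrary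
    lower bound.\<close>
  have le_codensity: "over (fobj L Y) (fobj (?K X) Y) (Idn B (fobj T (fobj p Y))) \<longleftrightarrow>
      (\<forall>f\<in>Hom E Y (fobj T' X).
        over (fobj L Y) (fobj T' X) (kleisli_ext B T (fobj p X) (farr p f)))"
    if L: "L \<in> Lift E B p T" and X: "X \<in> Obj E" and Y: "Y \<in> Obj E" for L X Y
  proof -
    have i: "Idn B (fobj T (fobj p Y)) \<in> Hom B (fobj p (fobj L Y)) (fobj T (fobj p Y))"
      using p.D.Idn_closed T.fobj_Obj p.fobj_Obj Y Lobj(2)[OF L Y] by simp
    have "kleisli_ext B T (fobj p X) (farr p f) \<cdot>\<^bsub>B\<^esub> Idn B (fobj T (fobj p Y)) =
        kleisli_ext B T (fobj p X) (farr p f)" if "f \<in> Hom E Y (fobj T' X)" for f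
      using p.D.Idn_right[OF T.kleisli_ext_closed[OF p.fobj_Obj[OF X]]]
        p.farr_closed[OF that] Lobj(2)[OF T' X] by simp
    then show ?thesis
      using over_codensity[OF T p.fobj_Obj[OF X] Lobj[OF T' X] Lobj(1)[OF L Y] Y i] by simp
  qed
  have K: "?K X \<in> Lift E B p T" if "X \<in> Obj E" for X
    using codensity_lifting_Lift[OF T p.fobj_Obj[OF that] Lobj[OF T' that]] .
  show ?thesis
  proof (rule greatest_LowerI)
    fix L assume "L \<in> ?K ` Obj E"
    then obtain X where X: "X \<in> Obj E" and L: "L = ?K X" by blast
    \<comment> \<open>For each \<open>f\<close> the witness is
      \<open>kleisli_ext E T' X f\<close>.\<close>
    have "over (fobj T' Y) (fobj (?K X) Y) (Idn B (fobj T (fobj p Y)))" if Y: "Y \<in> Obj E" for Y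
      unfolding le_codensity[OF T' X Y]
      using T'.kleisli_ext_closed[OF X] Lift_kleisli_ext[OF T' X] by blast
    then show "T' \<sqsubseteq>\<^bsub>lift_order E B p T\<^esub> L"
      by (simp add: L lift_order_def fibre_def)
  next
    fix L assume "L \<in> Lower (lift_order E B p T) (?K ` Obj E)"
    then have L: "L \<in> Lift E B p T"
      and le: "\<And>X Y. \<lbrakk>X \<in> Obj E; Y \<in> Obj E\<rbrakk> \<Longrightarrow>
        over (fobj L Y) (fobj (?K X) Y) (Idn B (fobj T (fobj p Y)))"
      using K by (auto simp: Lower_def lift_order_def fibre_def)
    have "over (fobj L Y) (fobj T' Y) (Idn B (fobj T (fobj p Y)))" if Y: "Y \<in> Obj E" for Y
    proof -
      have "over (fobj L Y) (fobj T' Y) (kleisli_ext B T (fobj p Y) (farr p (munit T' Y)))"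
        using le[OF Y Y] T'.munit_closed[OF Y] unfolding le_codensity[OF L Y Y] by blast
      moreover have "farr p (munit T' Y) = munit T (fobj p Y)"
        using T' Y by (simp add: Lift_def)
      ultimately show ?thesis
        using T.kleisli_ext_munit[OF p.fobj_Obj[OF Y]] by simp
    qed
    then show "L \<sqsubseteq>\<^bsub>lift_order E B p T\<^esub> T'"
      by (simp add: lift_order_def fibre_def)
  qed (use K T' in \<open>auto simp: lift_order_def\<close>)
qed

end

theorem theorem8p6:
  fixes E :: "('eo, 'ea) cat" and B :: "('bo, 'ba) cat"
    and p :: "('eo, 'ea, 'bo, 'ba) cfunctor"
    and T :: "('bo, 'ba) cmonad" and T' :: "('eo, 'ea) cmonad"
  assumes "posetal_fibration_limits E B p"
    and "cat_monad B T"
    and "T' \<in> Lift E B p T"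
  shows "T' = (IINF\<^bsub>lift_order E B p T\<^esub> X:Obj E. codensity_lifting E B p T (fobj p X) (q X T'))"
proof -
  interpret posetal_fibration_limits E B p by fact
  interpret L: partial_order "lift_order E B p T" by (rule lift_partial_order)
  note glb = Lift_is_glb_codensity[OF assms(2,3)]
  show ?thesis
    unfolding infi_def inf_def q_def
    \<comment> \<open>\<open>inf\<close> selects some greatest lower bound by choice. Since
      \<open>T'\<close> is one, the selected object is one too, and antisymmetry of the order on
      liftings identifies the two.\<close>
    by (rule L.greatest_unique[OF glb]) (rule someI, rule glb)
qed

end
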